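(* Let $\mathbb{E}_1,\mathbb{E}_2$ be finite-dimensional Euclidean spaces, let $\mathcal{A}:\mathbb{E}_1\to\mathbb{E}_2$ be linear, let $g:\mathbb{E}_2\to\mathbb{R}$ be strictly convex, and let $h:\mathbb{E}_1\to\mathbb{R}\cup\{+\infty\}$ be closed, proper and convex. Then $\mathcal{A}$ and $h$ are constant on the solution set $$\mathcal{X}^*:=\operatorname*{argmin}_{x\in\mathbb{E}_1}\{g(\mathcal{A}(x))+h(x)\}.$$
   Context: A function $h:\mathbb{E}_1\to\mathbb{R}\cup\{+\infty\}$ is proper if it is finite at some point, convex if its epigraph $\{(x,\alpha)\in\mathbb{E}_1\times\mathbb{R}:h(x)\le\alpha\}$ is convex, and closed if its epigraph is closed. *)

theory Defs
  imports "HOL-Analysis.Analysis"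
begin

(* The class euclidean_space forces a nonempty basis and hence excludes the zero space.
   To admit it, Euclidean spaces are inner product spaces satisfying this predicate. *)
definition finite_dimensional :: "'a::real_vector itself \<Rightarrow> bool" where
  "finite_dimensional _ \<longleftrightarrow> (\<exists>B :: 'a set. finite B \<and> span B = UNIV)"

definition strictly_convex_on :: "'a::real_vector set \<Rightarrow> ('a \<Rightarrow> real) \<Rightarrow> bool" where
  "strictly_convex_on S f \<longleftrightarrow> convex S \<and>
    (\<forall>x\<in>S. \<forall>y\<in>S. \<forall>u>0. \<forall>v>0. x \<noteq> y \<longrightarrow> u + v = 1 \<longrightarrow>
      f (u *\<^sub>R x + v *\<^sub>R y) < u * f x + v * f y)"

(* The library's epigraph and convex_on cover real-valued functions only. Heights in the
   epigraph are real numbers, also for extended-valued functions. *)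
definition ereal_epigraph :: "('a \<Rightarrow> ereal) \<Rightarrow> ('a \<times> real) set" where
  "ereal_epigraph h = {(x, \<alpha>). h x \<le> ereal \<alpha>}"

definition proper_fun :: "('a \<Rightarrow> ereal) \<Rightarrow> bool" where
  "proper_fun h \<longleftrightarrow> (\<exists>x. \<bar>h x\<bar> \<noteq> \<infinity>)"

definition convex_fun :: "('a::real_vector \<Rightarrow> ereal) \<Rightarrow> bool" where
  "convex_fun h \<longleftrightarrow> convex (ereal_epigraph h)"

definition closed_fun :: "('a::topological_space \<Rightarrow> ereal) \<Rightarrow> bool" where
  "closed_fun h \<longleftrightarrow> closed (ereal_epigraph h)"

definition argmin_set :: "('a \<Rightarrow> ereal) \<Rightarrow> 'a set" where
  "argmin_set f = {x. is_arg_min f (\<lambda>_. True) x}"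

end

theory Submission
  imports Defs
begin

text \<open>Let \<open>x\<close> and \<open>y\<close> be minimizers. Properness makes \<open>h\<close> finite at both. If \<open>A x \<noteq> A y\<close>, strict
  convexity of \<open>g\<close> and convexity of \<open>h\<close> would give the midpoint a strictly smaller objective value.
  Hence \<open>A x = A y\<close>, and equality of the objective values leaves \<open>h x = h y\<close>.\<close>

text \<open>The pairwise form also covers an empty \<open>S\<close>, where any value serves as the
  common one.\<close>

lemma constant_onI:
  assumes "\<And>x y. x \<in> S \<Longrightarrow> y \<in> S \<Longrightarrow> f x = f y"
  shows "f constant_on S"
  unfolding constant_on_def using assms by metis

text \<open>The midpoint of two epigraph points stays in the epigraph. Real bounds \<open>a\<close>
  and \<open>b\<close> serve as heights, so no extended arithmetic arises.\<close>

lemma convex_fun_midpoint_le: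
  assumes "convex_fun h" and "h x \<le> ereal a" and "h y \<le> ereal b"
  shows "h ((1/2) *\<^sub>R x + (1/2) *\<^sub>R y) \<le> ereal ((a + b) / 2)"
proof -
  have "(x, a) \<in> ereal_epigraph h" "(y, b) \<in> ereal_epigraph h"
    using assms(2,3) by (simp_all add: ereal_epigraph_def)
  with assms(1) have "(1/2) *\<^sub>R (x, a) + (1/2) *\<^sub>R (y, b) \<in> ereal_epigraph h"
    unfolding convex_fun_def by (intro convexD) auto
  then show ?thesis
    by (simp add: ereal_epigraph_def add_divide_distrib)
qed

lemma argmin_set_le: "x \<in> argmin_set f \<Longrightarrow> f x \<le> f z"
  by (auto simp: argmin_set_def is_arg_min_def not_less)

lemma argmin_set_finite:
  fixes G :: "'a \<Rightarrow> real"
  assumes "x \<in> argmin_set (\<lambda>x. ereal (G x) + h x)" and "\<And>x. h x \<noteq> -\<infinity>" and "proper_fun h"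
  obtains a where "h x = ereal a"
proof -
  obtain z where "\<bar>h z\<bar> \<noteq> \<infinity>"
    using assms(3) unfolding proper_fun_def ..
  \<comment> \<open>The right side is finite because \<open>G\<close> is real-valued, which rules
    out \<open>h x = \<infinity>\<close>.\<close>
  moreover have "ereal (G x) + h x \<le> ereal (G z) + h z"
    using argmin_set_le[OF assms(1)] .
  ultimately have "h x \<noteq> \<infinity>"
    by auto
  with assms(2)[of x] show thesis
    by (cases "h x") (auto intro: that)
qed

lemma argmin_set_eq:
  assumes "linear A" and g: "strictly_convex_on UNIV g"
    and h: "\<And>x. h x \<noteq> -\<infinity>" "proper_fun h" "convex_fun h"
    and x: "x \<in> argmin_set (\<lambda>x. ereal (g (A x)) + h x)"
    and y: "y \<in> argmin_set (\<lambda>x. ereal (g (A x)) + h x)"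
  shows "A x = A y \<and> h x = h y"
proof -
  obtain a where a: "h x = ereal a"
    using argmin_set_finite[OF x h(1,2)] .
  obtain b where b: "h y = ereal b"
    using argmin_set_finite[OF y h(1,2)] .
  \<comment> \<open>Each minimizer is compared with the other; finiteness turns the two inequalities
    into an equation of reals.\<close>
  have val: "g (A x) + a = g (A y) + b"
    using argmin_set_le[OF x, of y] argmin_set_le[OF y, of x] by (simp add: a b)
  define m where "m = (1/2) *\<^sub>R x + (1/2) *\<^sub>R y"
  have "h m \<le> ereal ((a + b) / 2)"
    unfolding m_def by (rule convex_fun_midpoint_le) (simp_all add: h(3) a b)
  then have "ereal (g (A x)) + h x \<le> ereal (g (A m)) + ereal ((a + b) / 2)"
    by (intro order_trans[OF argmin_set_le[OF x, of m]] add_left_mono)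
  then have min: "g (A x) + a \<le> g (A m) + (a + b) / 2"
    by (simp add: a)
  have Am: "A m = (1/2) *\<^sub>R A x + (1/2) *\<^sub>R A y"
    unfolding m_def using \<open>linear A\<close> by (simp add: linear_add linear_scale)
  have "A x = A y"
  proof (rule ccontr)
    assume "A x \<noteq> A y"
    then have "g (A m) < (1/2) * g (A x) + (1/2) * g (A y)"
      using g[unfolded strictly_convex_on_def, THEN conjunct2, rule_format, of "A x" "A y" "1/2" "1/2"]
      by (simp add: Am)
    \<comment> \<open>By \<open>val\<close>, the common minimum is the average of the two objective
      values, and strict convexity puts \<open>g (A m) + (a + b) / 2\<close> strictly below it,
      against \<open>min\<close>.\<close>
    with val min show False
      by (simp add: field_simps)
  qed
  with val show ?thesis
    by (simp add: a b)
qed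

theorem proposition4p9:
  fixes A :: "'a::real_inner \<Rightarrow> 'b::real_inner"
    and g :: "'b \<Rightarrow> real"
    and h :: "'a \<Rightarrow> ereal"
  assumes "finite_dimensional TYPE('a)"
    and "finite_dimensional TYPE('b)"
    and "linear A"
    and "strictly_convex_on UNIV g"
    and "\<And>x. h x \<noteq> -\<infinity>"
    and "closed_fun h"
    and "proper_fun h"
    and "convex_fun h"
  shows "A constant_on argmin_set (\<lambda>x. ereal (g (A x)) + h x)
    \<and> h constant_on argmin_set (\<lambda>x. ereal (g (A x)) + h x)"
  by (intro conjI constant_onI) (use argmin_set_eq[OF assms(3,4,5,7,8)] in blast)+

end
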